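(* Let $A$ be an $n \times n$ complex Hermitian matrix with real eigenvalues $\lambda_1(A) \leq \dots \leq \lambda_n(A)$ (counted with multiplicity), and let $v_1,\dots,v_n \in \mathbb{C}^n$ be an orthonormal basis of eigenvectors of $A$ with $A v_i = \lambda_i(A) v_i$ for $i=1,\dots,n$. For $1 \leq i,j \leq n$ let $v_{i,j}$ denote the $j^{\mathrm{th}}$ component of $v_i$. For $1 \leq j \leq n$ let $M_j$ be the $(n-1)\times(n-1)$ Hermitian matrix obtained from $A$ by deleting the $j^{\mathrm{th}}$ row and the $j^{\mathrm{th}}$ column, with real eigenvalues $\lambda_1(M_j) \leq \dots \leq \lambda_{n-1}(M_j)$ (counted with multiplicity). Then for all $i,j \in \{1,\dots,n\}$, $$|v_{i,j}|^2\prod_{k=1;\,k\neq i}^{n}\left(\lambda_i(A)-\lambda_k(A)\right)=\prod_{k=1}^{n-1}\left(\lambda_i(A)-\lambda_k(M_j)\right).$$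
   Context: Empty products are equal to $1$. *)

theory Defs
  imports
    "Jordan_Normal_Form.Schur_Decomposition"
    "Jordan_Normal_Form.VS_Connect"
    "HOL-Computational_Algebra.Fundamental_Theorem_Algebra"
begin

definition hermitian :: "complex mat \<Rightarrow> bool" where
  "hermitian A \<longleftrightarrow> mat_adjoint A = A"

text \<open>
  The eigenvalues of a Hermitian matrix in increasing order, counted with their multiplicity as roots
  of the characteristic polynomial; entry \<open>k\<close> of the list (counting from 0) is
  \<open>\<lambda>\<^sub>k\<^sub>+\<^sub>1(A)\<close>. All roots are real if the matrix is Hermitian, so that \<^const>\<open>Re\<close> is then merely
  the change of type from the complex to the real numbers: see \<open>char_poly_eigvals\<close>.
\<close>

definition eigvals :: "complex mat \<Rightarrow> real list" where
  "eigvals A = sorted_list_of_multiset (image_mset Re (proots (char_poly A)))"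

text \<open>The Hermitian inner product \<open>\<bullet>c\<close> is conjugate-linear in its second argument.\<close>

definition orthonormal_basis :: "nat \<Rightarrow> (nat \<Rightarrow> complex vec) \<Rightarrow> bool" where
  "orthonormal_basis n v \<longleftrightarrow>
     vectorspace.basis class_ring (module_vec TYPE(complex) n) (v ` {..<n}) \<and>
     (\<forall>i<n. \<forall>k<n. v i \<bullet>c v k = (if i = k then 1 else 0))"

lemma hermitian_iff:
  assumes A: "A \<in> carrier_mat n n"
  shows "hermitian A \<longleftrightarrow> (\<forall>i<n. \<forall>j<n. A $$ (i, j) = cnj (A $$ (j, i)))"
proof -
  have d: "mat_adjoint A $$ (i, j) = cnj (A $$ (j, i))" if "i < n" "j < n" for i j
    using A that by (auto simp: mat_adjoint_def mat_of_rows_index)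
  have "dim_row (mat_adjoint A) = n" "dim_col (mat_adjoint A) = n"
    using A by (auto simp: mat_adjoint_def)
  then show ?thesis
    using A d unfolding hermitian_def by (metis (no_types, lifting) carrier_matD(1) carrier_matD(2) eq_matI)
qed

lemma hermitian_mat_delete:
  assumes A: "A \<in> carrier_mat n n" and "hermitian A" and j: "j < n"
  shows "hermitian (mat_delete A j j)"
proof -
  have M: "mat_delete A j j \<in> carrier_mat (n - 1) (n - 1)"
    using A by (rule mat_delete_carrier)
  show ?thesis
    unfolding hermitian_iff[OF M]
  proof (intro allI impI)
    fix i k assume "i < n - 1" "k < n - 1"
    then have e: "mat_delete A j j $$ (a, b) = A $$ (insert_index j a, insert_index j b)"
      if "a < n - 1" "b < n - 1" for a b
      using that A j mat_delete_index[of A "n - 1" j j a b] by simp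
    have "insert_index j i < n" "insert_index j k < n"
      using \<open>i < n - 1\<close> \<open>k < n - 1\<close> by (auto simp: insert_index_def)
    then show "mat_delete A j j $$ (i, k) = cnj (mat_delete A j j $$ (k, i))"
      using e \<open>i < n - 1\<close> \<open>k < n - 1\<close> assms(2) unfolding hermitian_iff[OF A] by metis
  qed
qed

lemma hermitian_eigenvalue_real:
  assumes A: "A \<in> carrier_mat n n" and h: "hermitian A" and e: "eigenvalue A k"
  shows "k \<in> \<real>"
proof -
  obtain v where v: "v \<in> carrier_vec n" "v \<noteq> 0\<^sub>v n" "A *\<^sub>v v = k \<cdot>\<^sub>v v"
    using e A by (auto simp: eigenvalue_def eigenvector_def)
  define N where "N = v \<bullet>c v"
  have N: "N = (\<Sum>i<n. v $ i * cnj (v $ i))"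
    using v(1) by (simp add: N_def scalar_prod_def atLeast0LessThan)
  have row: "(\<Sum>j<n. A $$ (i, j) * v $ j) = k * v $ i" if "i < n" for i
  proof -
    have "(A *\<^sub>v v) $ i = (\<Sum>j<n. A $$ (i, j) * v $ j)"
      using that A v(1) by (simp add: scalar_prod_def atLeast0LessThan)
    then show ?thesis using v that by simp
  qed
  have "k * N = (\<Sum>i<n. (\<Sum>j<n. A $$ (i, j) * v $ j) * cnj (v $ i))"
    unfolding N sum_distrib_left by (rule sum.cong) (auto simp: row)
  also have "\<dots> = (\<Sum>i<n. \<Sum>j<n. A $$ (i, j) * v $ j * cnj (v $ i))"
    by (simp add: sum_distrib_right)
  also have "\<dots> = (\<Sum>j<n. \<Sum>i<n. A $$ (i, j) * v $ j * cnj (v $ i))"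
    by (rule sum.swap)
  also have "\<dots> = (\<Sum>j<n. v $ j * cnj (\<Sum>i<n. A $$ (j, i) * v $ i))"
  proof (rule sum.cong)
    fix j assume "j \<in> {..<n}"
    then have sym: "\<forall>i<n. cnj (A $$ (j, i)) = A $$ (i, j)"
      using h unfolding hermitian_iff[OF A] by (metis lessThan_iff)
    show "(\<Sum>i<n. A $$ (i, j) * v $ j * cnj (v $ i)) = v $ j * cnj (\<Sum>i<n. A $$ (j, i) * v $ i)"
      unfolding cnj_sum sum_distrib_left by (intro sum.cong) (simp_all add: sym)
  qed simp
  also have "\<dots> = (\<Sum>j<n. cnj k * (v $ j * cnj (v $ j)))"
    by (rule sum.cong) (auto simp: row)
  also have "\<dots> = cnj k * N" by (simp add: N sum_distrib_left)
  finally have "k * N = cnj k * N" .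
  moreover have "N \<noteq> 0" using v conjugate_square_eq_0_vec[of v n] by (simp add: N_def)
  ultimately show ?thesis by (simp add: Reals_cnj_iff)
qed

lemma char_poly_eigvals:
  assumes A: "A \<in> carrier_mat n n" and h: "hermitian A"
  shows "char_poly A = (\<Prod>x\<leftarrow>eigvals A. [:- complex_of_real x, 1:])"
    and "length (eigvals A) = n"
    and "sorted (eigvals A)"
proof -
  have m: "degree (char_poly A) = n" "monic (char_poly A)"
    using degree_monic_char_poly[OF A] by auto
  then have nz: "char_poly A \<noteq> 0" by auto
  have ms: "mset (eigvals A) = image_mset Re (proots (char_poly A))"
    by (simp add: eigvals_def)
  have "image_mset (complex_of_real \<circ> Re) (proots (char_poly A)) = image_mset id (proots (char_poly A))"
    using hermitian_eigenvalue_real[OF A h] nz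
    by (intro image_mset_cong) (auto simp: eigenvalue_root_char_poly[OF A])
  then have "image_mset complex_of_real (mset (eigvals A)) = proots (char_poly A)"
    by (simp add: ms multiset.map_comp)
  then have "(\<Prod>x\<in>#proots (char_poly A). [:- x, 1:]) =
             (\<Prod>x\<in>#mset (eigvals A). [:- complex_of_real x, 1:])"
    by (metis (no_types, lifting) comp_apply image_mset_cong multiset.map_comp)
  also have "\<dots> = (\<Prod>x\<leftarrow>eigvals A. [:- complex_of_real x, 1:])"
    by (metis mset_map prod_mset_prod_list)
  finally show "char_poly A = (\<Prod>x\<leftarrow>eigvals A. [:- complex_of_real x, 1:])"
    using complex_poly_decompose_multiset[of "char_poly A"] m by simp
  show "length (eigvals A) = n"
    using m ms size_proots_complex[of "char_poly A"] by (metis size_image_mset size_mset)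
  show "sorted (eigvals A)" by (simp add: eigvals_def)
qed

end

theory Submission
  imports Defs
begin

text \<open>
  The identity is the diagonal entry at \<open>(j, j)\<close> of a formula for the adjugate of \<open>x - A\<close>.
  If the \<open>v\<^sub>k\<close> are an orthonormal eigenbasis of \<open>A\<close> with eigenvalues \<open>\<lambda>\<^sub>k\<close>, then
  \<open>adj (x - A) = \<Sum>\<^sub>k (\<Prod>\<^sub>l\<^sub>\<noteq>\<^sub>k (x - \<lambda>\<^sub>l)) v\<^sub>k v\<^sub>k\<^sup>*\<close>:
  multiplying the right-hand side by \<open>x - A\<close> from the left restores the missing factor
  \<open>x - \<lambda>\<^sub>k\<close> in each summand, and \<open>\<Sum>\<^sub>k v\<^sub>k v\<^sub>k\<^sup>* = 1\<close>, so that the product is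
  \<open>det (x - A)\<close> times the identity. If \<open>x\<close> is not an eigenvalue, this determines the adjugate
  (\<open>adj_mat_eqI\<close>).

  The \<open>(j, j)\<close> entry of the adjugate is the minor \<open>det (x - M\<^sub>j)\<close>, the value at \<open>x\<close> of the
  characteristic polynomial of \<open>M\<^sub>j\<close> (\<open>adj_mat_char_matrix_diag\<close>). Hence
  \<open>char_poly M\<^sub>j = \<Sum>\<^sub>k \<bar>v\<^sub>k\<^sub>,\<^sub>j\<bar>\<^sup>2 \<Prod>\<^sub>l\<^sub>\<noteq>\<^sub>k (X - \<lambda>\<^sub>l)\<close> off the spectrum of \<open>A\<close>, and therefore as
  polynomials (\<open>char_poly_mat_delete_eigenbasis\<close>). This permits the substitution
  \<open>x = \<lambda>\<^sub>i\<close>, for which only the summand \<open>k = i\<close> survives, whatever the multiplicity of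
  \<open>\<lambda>\<^sub>i\<close>.
\<close>

text \<open>
  An invertible \<open>B\<close> has only one right inverse, and the adjugate is that inverse scaled by
  \<open>det B\<close>.
\<close>

lemma adj_mat_eqI:
  fixes B :: "'a :: field mat"
  assumes B: "B \<in> carrier_mat n n" and C: "C \<in> carrier_mat n n"
    and BC: "B * C = det B \<cdot>\<^sub>m 1\<^sub>m n" and nz: "det B \<noteq> 0"
  shows "adj_mat B = C"
proof -
  note adj = adj_mat[OF B]
  have "det B \<cdot>\<^sub>m adj_mat B = adj_mat B * (B * C)"
    using adj(1) by (simp add: BC mult_smult_distrib[OF adj(1) one_carrier_mat])
  also have "\<dots> = adj_mat B * B * C"
    using adj(1) B C by (simp add: assoc_mult_mat)
  also have "\<dots> = det B \<cdot>\<^sub>m C"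
    using C by (simp add: adj(3) mult_smult_assoc_mat[OF one_carrier_mat C])
  finally have eq: "det B \<cdot>\<^sub>m adj_mat B = det B \<cdot>\<^sub>m C" .
  show ?thesis
  proof (rule eq_matI)
    fix a b assume "a < dim_row C" "b < dim_col C"
    then have "det B * adj_mat B $$ (a, b) = det B * C $$ (a, b)"
      using arg_cong[OF eq, of "\<lambda>M. M $$ (a, b)"] adj(1) C by simp
    then show "adj_mat B $$ (a, b) = C $$ (a, b)" using nz by simp
  qed (use adj(1) C in auto)
qed

lemma adj_mat_char_matrix_diag:
  fixes A :: "'a :: field mat"
  assumes A: "A \<in> carrier_mat n n" and j: "j < n"
  shows "adj_mat (- char_matrix A x) $$ (j, j) = poly (char_poly (mat_delete A j j)) x"
proof -
  have M: "mat_delete A j j \<in> carrier_mat (n - 1) (n - 1)"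
    using A by (rule mat_delete_carrier)
  have "mat_delete (- char_matrix A x) j j = - char_matrix (mat_delete A j j) x"
    using A j by (intro eq_matI) (auto simp: mat_delete_def char_matrix_def)
  moreover have "(- 1 :: 'a) ^ (j + j) = 1"
    by (simp flip: mult_2)
  ultimately show ?thesis
    using A j by (simp add: adj_mat_def cofactor_def char_poly_matrix[OF M] char_matrix_def)
qed

text \<open>
  A square matrix with orthonormal columns also has orthonormal rows, because a left inverse of a
  square matrix is a right inverse. This is the resolution of the identity
  \<open>\<Sum>\<^sub>k v\<^sub>k v\<^sub>k\<^sup>* = 1\<close>.
\<close>

lemma orthonormal_resolution_of_identity:
  fixes v :: "nat \<Rightarrow> complex vec"
  assumes v: "\<And>k. k < n \<Longrightarrow> v k \<in> carrier_vec n"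
    and orth: "\<And>i k. i < n \<Longrightarrow> k < n \<Longrightarrow> v i \<bullet>c v k = (if i = k then 1 else 0)"
    and ab: "a < n" "b < n"
  shows "(\<Sum>k<n. v k $ a * cnj (v k $ b)) = (if a = b then 1 else 0)"
proof -
  define V where "V = mat n n (\<lambda>(a, k). v k $ a)"
  define W where "W = mat n n (\<lambda>(k, b). cnj (v k $ b))"
  have V: "V \<in> carrier_mat n n" and W: "W \<in> carrier_mat n n"
    by (auto simp: V_def W_def)
  have "W * V = 1\<^sub>m n"
  proof (rule eq_matI)
    fix i k assume "i < dim_row (1\<^sub>m n)" "k < dim_col (1\<^sub>m n)"
    then have ik: "i < n" "k < n" by auto
    then have "(W * V) $$ (i, k) = v k \<bullet>c v i"
      using carrier_vecD[OF v[of i]]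
      by (auto simp: V_def W_def scalar_prod_def mult.commute intro!: sum.cong)
    then show "(W * V) $$ (i, k) = 1\<^sub>m n $$ (i, k)"
      using ik orth by auto
  qed (auto simp: V_def W_def)
  then have "V * W = 1\<^sub>m n" by (rule mat_mult_left_right_inverse[OF W V])
  then have "(V * W) $$ (a, b) = (if a = b then 1 else 0)" using ab by simp
  then show ?thesis
    using ab by (simp add: V_def W_def scalar_prod_def atLeast0LessThan)
qed

text \<open>
  This is stated for polynomials because the point of interest, an eigenvalue of \<open>A\<close>, is one where
  \<open>x - A\<close> is singular and the adjugate cannot be recovered by cancelling \<open>x - A\<close>. Away from the
  eigenvalues the cancellation works, and these points are enough to fix a polynomial.
\<close>

lemma char_poly_mat_delete_eigenbasis:
  fixes A :: "complex mat" and v :: "nat \<Rightarrow> complex vec" and l :: "nat \<Rightarrow> complex"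
  assumes A: "A \<in> carrier_mat n n"
    and v: "\<And>k. k < n \<Longrightarrow> v k \<in> carrier_vec n"
    and orth: "\<And>i k. i < n \<Longrightarrow> k < n \<Longrightarrow> v i \<bullet>c v k = (if i = k then 1 else 0)"
    and eig: "\<And>k. k < n \<Longrightarrow> A *\<^sub>v v k = l k \<cdot>\<^sub>v v k"
    and cp: "char_poly A = (\<Prod>k<n. [:- l k, 1:])"
    and j: "j < n"
  shows "char_poly (mat_delete A j j) =
    (\<Sum>k<n. smult (v k $ j * cnj (v k $ j)) (\<Prod>m\<in>{..<n} - {k}. [:- l m, 1:]))"
    (is "?p = ?q")
proof -
  have agree: "poly ?p x = poly ?q x" if x: "poly (char_poly A) x \<noteq> 0" for x
  proof -
    define B where "B = - char_matrix A x"
    \<comment> \<open>The spectral form of the adjugate, \<open>\<Sum>\<^sub>k (\<Prod>\<^sub>m\<^sub>\<noteq>\<^sub>k (x - l\<^sub>m)) v\<^sub>k v\<^sub>k\<^sup>*\<close>.\<close>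
    define C where "C = mat n n (\<lambda>(a, b). \<Sum>k<n. v k $ a * cnj (v k $ b) * (\<Prod>m\<in>{..<n} - {k}. x - l m))"
    have B: "B \<in> carrier_mat n n" and C: "C \<in> carrier_mat n n"
      using A by (auto simp: B_def C_def)
    have detB: "det B = poly (char_poly A) x"
      by (simp add: B_def char_poly_matrix[OF A])
    have Bv: "(\<Sum>c<n. B $$ (a, c) * v k $ c) = (x - l k) * v k $ a" if "a < n" "k < n" for a k
    proof -
      have Av: "(\<Sum>c<n. A $$ (a, c) * v k $ c) = l k * v k $ a"
        using arg_cong[OF eig[OF \<open>k < n\<close>], of "\<lambda>w. w $ a"] that A v[of k]
        by (simp add: scalar_prod_def atLeast0LessThan)
      have "(\<Sum>c<n. B $$ (a, c) * v k $ c) =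
          (\<Sum>c<n. (if c = a then x * v k $ c else 0) - A $$ (a, c) * v k $ c)"
        using A that by (intro sum.cong) (auto simp: B_def char_matrix_def algebra_simps)
      also have "\<dots> = x * v k $ a - l k * v k $ a"
        using that by (simp add: sum_subtractf Av)
      finally show ?thesis by (simp add: algebra_simps)
    qed
    have "B * C = det B \<cdot>\<^sub>m 1\<^sub>m n"
    proof (rule eq_matI)
      fix a b assume "a < dim_row (det B \<cdot>\<^sub>m 1\<^sub>m n)" "b < dim_col (det B \<cdot>\<^sub>m 1\<^sub>m n)"
      then have ab: "a < n" "b < n" by auto
      have "(B * C) $$ (a, b) = (\<Sum>c<n. B $$ (a, c) * C $$ (c, b))"
        using ab B C by (simp add: scalar_prod_def atLeast0LessThan)
      also have "\<dots> = (\<Sum>c<n. \<Sum>k<n. B $$ (a, c) * v k $ c *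
          (cnj (v k $ b) * (\<Prod>m\<in>{..<n} - {k}. x - l m)))"
        using ab by (simp add: C_def sum_distrib_left mult_ac)
      also have "\<dots> = (\<Sum>k<n. (\<Sum>c<n. B $$ (a, c) * v k $ c) *
          (cnj (v k $ b) * (\<Prod>m\<in>{..<n} - {k}. x - l m)))"
        by (subst sum.swap) (simp add: sum_distrib_right)
      also have "\<dots> = (\<Sum>k<n. (v k $ a * cnj (v k $ b)) *
          ((x - l k) * (\<Prod>m\<in>{..<n} - {k}. x - l m)))"
        using ab by (intro sum.cong) (simp_all only: Bv lessThan_iff, simp add: mult_ac)
      also have "\<dots> = (\<Sum>k<n. (v k $ a * cnj (v k $ b)) * det B)"
      proof (intro sum.cong refl arg_cong2[where f = "(*)"])
        fix k assume "k \<in> {..<n}"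
        then show "(x - l k) * (\<Prod>m\<in>{..<n} - {k}. x - l m) = det B"
          by (simp add: detB cp poly_prod prod.remove[of "{..<n}" k] algebra_simps)
      qed
      also have "\<dots> = (if a = b then 1 else 0) * det B"
        unfolding sum_distrib_right[symmetric]
        using orthonormal_resolution_of_identity[OF v orth ab] by simp
      finally show "(B * C) $$ (a, b) = (det B \<cdot>\<^sub>m 1\<^sub>m n) $$ (a, b)"
        using ab by simp
    qed (use B C in auto)
    then have "adj_mat B = C"
      using x by (intro adj_mat_eqI[OF B C]) (simp_all add: detB)
    then have "poly ?p x = C $$ (j, j)"
      using adj_mat_char_matrix_diag[OF A j, of x] by (simp add: B_def)
    also have "\<dots> = poly ?q x"
      using j by (simp add: C_def poly_sum poly_prod)
    finally show ?thesis .
  qed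
  have "char_poly A \<noteq> 0" using degree_monic_char_poly[OF A] by auto
  \<comment> \<open>Multiplying by \<open>char_poly A\<close> extends the agreement to the eigenvalues of \<open>A\<close>.\<close>
  moreover have "char_poly A * ?p = char_poly A * ?q"
    by (rule poly_ext) (use agree in force)
  ultimately show ?thesis by simp
qed

theorem theorem1:
  fixes A :: "complex mat" and v :: "nat \<Rightarrow> complex vec" and n i j :: nat
  assumes "A \<in> carrier_mat n n"
    and "hermitian A"
    and "orthonormal_basis n v"
    and "\<And>k. k < n \<Longrightarrow> A *\<^sub>v v k = complex_of_real (eigvals A ! k) \<cdot>\<^sub>v v k"
    and "i < n" and "j < n"
  shows "(cmod (v i $ j))\<^sup>2 * (\<Prod>k\<in>{..<n} - {i}. eigvals A ! i - eigvals A ! k)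
       = (\<Prod>k<n - 1. eigvals A ! i - eigvals (mat_delete A j j) ! k)"
proof -
  define M where "M = mat_delete A j j"
  let ?l = "\<lambda>k. complex_of_real (eigvals A ! k)"
  interpret vec_space "TYPE(complex)" n .
  have v: "v k \<in> carrier_vec n" if "k < n" for k
    using assms(3) that unfolding orthonormal_basis_def basis_def by auto
  have orth: "v i \<bullet>c v k = (if i = k then 1 else 0)" if "i < n" "k < n" for i k
    using assms(3) that unfolding orthonormal_basis_def by auto
  have M: "M \<in> carrier_mat (n - 1) (n - 1)"
    unfolding M_def using assms(1) by (rule mat_delete_carrier)
  have hM: "hermitian M"
    unfolding M_def using assms by (intro hermitian_mat_delete)
  have split: "(\<Prod>x\<leftarrow>xs. [:- complex_of_real x, 1:]) =
      (\<Prod>k<length xs. [:- complex_of_real (xs ! k), 1:])" for xs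
    by (simp add: prod.list_conv_set_nth atLeast0LessThan)
  have cpA: "char_poly A = (\<Prod>k<n. [:- ?l k, 1:])"
    using char_poly_eigvals(1,2)[OF assms(1,2)] by (simp add: split)
  have cpM: "char_poly M = (\<Prod>k<n - 1. [:- complex_of_real (eigvals M ! k), 1:])"
    using char_poly_eigvals(1,2)[OF M hM] by (simp add: split)
  have "complex_of_real (\<Prod>k<n - 1. eigvals A ! i - eigvals M ! k) = poly (char_poly M) (?l i)"
    by (simp add: cpM poly_prod)
  also have "\<dots> = (\<Sum>k<n. v k $ j * cnj (v k $ j) * (\<Prod>m\<in>{..<n} - {k}. ?l i - ?l m))"
    unfolding M_def
    by (simp add: char_poly_mat_delete_eigenbasis[OF assms(1) v orth assms(4) cpA assms(6)]
        poly_sum poly_prod)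
  \<comment> \<open>For \<open>k \<noteq> i\<close> the product contains the factor \<open>m = i\<close>, which vanishes.\<close>
  also have "\<dots> = (\<Sum>k\<in>{i}. v k $ j * cnj (v k $ j) * (\<Prod>m\<in>{..<n} - {k}. ?l i - ?l m))"
    using assms(5) by (intro sum.mono_neutral_right) (auto simp: prod_zero_iff)
  also have "\<dots> = complex_of_real ((cmod (v i $ j))\<^sup>2 * (\<Prod>k\<in>{..<n} - {i}. eigvals A ! i - eigvals A ! k))"
    by (simp add: complex_norm_square del: of_real_power)
  finally show ?thesis
    unfolding M_def of_real_eq_iff by simp
qed

end
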